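(* Every Ehresmann semigroup has a proper cover; that is, for every Ehresmann semigroup $S$ there exist a proper Ehresmann semigroup $Q$ and a surjective projection-separating morphism of Ehresmann semigroups $\varphi\colon Q\to S$.
   Context: **Ehresmann semigroups.** An Ehresmann semigroup is an algebra $(S;\cdot\,,{}^+,{}^* )$ with $(S;\cdot)$ a semigroup and unary operations ${}^+,{}^*$ satisfying $x^+x=x$, $(x^+y^+)^+=x^+y^+=y^+x^+$, $(xy)^+=(xy^+)^+$, $xx^*=x$, $(x^*y^* )^*=x^*y^*=y^*x^*$, $(xy)^*=(x^*y)^*$, $(x^+)^*=x^+$, $(x^* )^+=x^*$. Morphisms preserve all three operations. $P(S)=\{s^+\colon s\in S\}=\{s^*\colon s\in S\}$ is the semilattice of projections. A morphism $\varphi\colon Q\to S$ is projection-separating if it is injective on $P(Q)$. The natural partial order: $a\leq b$ iff $a=ebf$ for some $e,f\in P(S)$. $\sigma$ is the minimum congruence on $S$ identifying all elements of $P(S)$. **Proper Ehresmann semigroups.** A matching factorization of $s\in S$ is a tuple $(s_1,\dots,s_n)$ of elements of $S$, $n\ge1$, with $s=s_1\cdots s_n$ and $s_i^*=s_{i+1}^+$ for $1\le i\le n-1$. An element $s$ is proper if for all $t\in S$: $t^+=s^+$, $t^*=s^*$ and $t\mathrel{\sigma}s$ imply $t=s$. A matching factorization $(s_1,\dots,s_n)$ is into a product of proper elements (respectively of elements of a subset $Y\subseteq S$) if all $s_i$ are proper (respectively belong to $Y$). If $(s_1,\dots,s_n)$ is a matching factorization of $s$ into a product of proper elements and $i\le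 j$ are such that $t=s_i\cdots s_j$ is a proper element of $S$, then $(s_1,\dots,s_{i-1},t,s_{j+1},\dots,s_n)$ is also a matching factorization of $s$ into a product of proper elements, and one writes $(s_1,\dots,s_n)\to(s_1,\dots,s_{i-1},t,s_{j+1},\dots,s_n)$. Two matching factorizations of $s$ into products of proper elements are equivalent if one can be obtained from the other by finitely many applications of the relation $\to$ or its inverse. $S$ is proper if it has an order ideal $Y$ with respect to $\leq$ such that $P(S)\subseteq Y$, all elements of $Y$ are proper, and each $s\in S$ admits a unique, up to equivalence, matching factorization as a product of elements of $Y$. *)

theory Defs
  imports "HOL-Algebra.Congruence"
begin

section \<open>Ehresmann semigroups\<close>

record 'a ehresmann = "'a partial_object" +
  mult :: "'a \<Rightarrow> 'a \<Rightarrow> 'a" (infixl \<open>\<cdot>\<index>\<close> 70)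
  plus_op :: "'a \<Rightarrow> 'a" (\<open>_\<^bsup>+\<^esup>\<index>\<close> [1000] 999)
  star_op :: "'a \<Rightarrow> 'a" (\<open>_\<^bsup>*\<^esup>\<index>\<close> [1000] 999)

locale ehresmann_semigroup =
  fixes S :: "('a, 'm) ehresmann_scheme" (structure)
  assumes mult_closed: "\<lbrakk>x \<in> carrier S; y \<in> carrier S\<rbrakk> \<Longrightarrow> x \<cdot> y \<in> carrier S"
    and plus_closed: "x \<in> carrier S \<Longrightarrow> x\<^bsup>+\<^esup> \<in> carrier S"
    and star_closed: "x \<in> carrier S \<Longrightarrow> x\<^bsup>*\<^esup> \<in> carrier S"
    and mult_assoc: "\<lbrakk>x \<in> carrier S; y \<in> carrier S; z \<in> carrier S\<rbrakk> \<Longrightarrow> (x \<cdot> y) \<cdot> z = x \<cdot> (y \<cdot> z)"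
    and plus_mult: "x \<in> carrier S \<Longrightarrow> x\<^bsup>+\<^esup> \<cdot> x = x"
    and plus_mult_plus: "\<lbrakk>x \<in> carrier S; y \<in> carrier S\<rbrakk> \<Longrightarrow> (x\<^bsup>+\<^esup> \<cdot> y\<^bsup>+\<^esup>)\<^bsup>+\<^esup> = x\<^bsup>+\<^esup> \<cdot> y\<^bsup>+\<^esup>"
    and plus_comm: "\<lbrakk>x \<in> carrier S; y \<in> carrier S\<rbrakk> \<Longrightarrow> x\<^bsup>+\<^esup> \<cdot> y\<^bsup>+\<^esup> = y\<^bsup>+\<^esup> \<cdot> x\<^bsup>+\<^esup>"
    and plus_of_mult: "\<lbrakk>x \<in> carrier S; y \<in> carrier S\<rbrakk> \<Longrightarrow> (x \<cdot> y)\<^bsup>+\<^esup> = (x \<cdot> y\<^bsup>+\<^esup>)\<^bsup>+\<^esup>"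
    and mult_star: "x \<in> carrier S \<Longrightarrow> x \<cdot> x\<^bsup>*\<^esup> = x"
    and star_mult_star: "\<lbrakk>x \<in> carrier S; y \<in> carrier S\<rbrakk> \<Longrightarrow> (x\<^bsup>*\<^esup> \<cdot> y\<^bsup>*\<^esup>)\<^bsup>*\<^esup> = x\<^bsup>*\<^esup> \<cdot> y\<^bsup>*\<^esup>"
    and star_comm: "\<lbrakk>x \<in> carrier S; y \<in> carrier S\<rbrakk> \<Longrightarrow> x\<^bsup>*\<^esup> \<cdot> y\<^bsup>*\<^esup> = y\<^bsup>*\<^esup> \<cdot> x\<^bsup>*\<^esup>"
    and star_of_mult: "\<lbrakk>x \<in> carrier S; y \<in> carrier S\<rbrakk> \<Longrightarrow> (x \<cdot> y)\<^bsup>*\<^esup> = (x\<^bsup>*\<^esup> \<cdot> y)\<^bsup>*\<^esup>"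
    and star_of_plus: "x \<in> carrier S \<Longrightarrow> (x\<^bsup>+\<^esup>)\<^bsup>*\<^esup> = x\<^bsup>+\<^esup>"
    and plus_of_star: "x \<in> carrier S \<Longrightarrow> (x\<^bsup>*\<^esup>)\<^bsup>+\<^esup> = x\<^bsup>*\<^esup>"

definition ehresmann_hom ::
  "('a, 'm) ehresmann_scheme \<Rightarrow> ('b, 'n) ehresmann_scheme \<Rightarrow> ('a \<Rightarrow> 'b) \<Rightarrow> bool" where
  "ehresmann_hom Q S \<phi> \<longleftrightarrow>
    (\<forall>x\<in>carrier Q. \<phi> x \<in> carrier S) \<and>
    (\<forall>x\<in>carrier Q. \<forall>y\<in>carrier Q. \<phi> (x \<cdot>\<^bsub>Q\<^esub> y) = \<phi> x \<cdot>\<^bsub>S\<^esub> \<phi> y) \<and>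
    (\<forall>x\<in>carrier Q. \<phi> (x\<^bsup>+\<^esup>\<^bsub>Q\<^esub>) = (\<phi> x)\<^bsup>+\<^esup>\<^bsub>S\<^esub>) \<and>
    (\<forall>x\<in>carrier Q. \<phi> (x\<^bsup>*\<^esup>\<^bsub>Q\<^esub>) = (\<phi> x)\<^bsup>*\<^esup>\<^bsub>S\<^esub>)"

definition projections :: "('a, 'm) ehresmann_scheme \<Rightarrow> 'a set" where
  "projections S = (\<lambda>s. s\<^bsup>+\<^esup>\<^bsub>S\<^esub>) ` carrier S"

lemma (in ehresmann_semigroup) projections_eq_star: "projections S = (\<lambda>s. s\<^bsup>*\<^esup>) ` carrier S"
proof
  show "projections S \<subseteq> (\<lambda>s. s\<^bsup>*\<^esup>) ` carrier S"
    unfolding projections_def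
  proof (rule image_subsetI)
    fix x assume "x \<in> carrier S"
    then show "x\<^bsup>+\<^esup> \<in> (\<lambda>s. s\<^bsup>*\<^esup>) ` carrier S"
      by (intro image_eqI[of _ _ "x\<^bsup>+\<^esup>"]) (simp_all add: star_of_plus plus_closed)
  qed
  show "(\<lambda>s. s\<^bsup>*\<^esup>) ` carrier S \<subseteq> projections S"
    unfolding projections_def
  proof (rule image_subsetI)
    fix x assume "x \<in> carrier S"
    then show "x\<^bsup>*\<^esup> \<in> (\<lambda>s. s\<^bsup>+\<^esup>) ` carrier S"
      by (intro image_eqI[of _ _ "x\<^bsup>*\<^esup>"]) (simp_all add: plus_of_star star_closed)
  qed
qed

definition projection_separating ::
  "('a, 'm) ehresmann_scheme \<Rightarrow> ('a \<Rightarrow> 'b) \<Rightarrow> bool" where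
  "projection_separating Q \<phi> \<longleftrightarrow> inj_on \<phi> (projections Q)"

definition nat_le :: "('a, 'm) ehresmann_scheme \<Rightarrow> 'a \<Rightarrow> 'a \<Rightarrow> bool" where
  "nat_le S a b \<longleftrightarrow> a \<in> carrier S \<and> b \<in> carrier S \<and>
    (\<exists>e\<in>projections S. \<exists>f\<in>projections S. a = e \<cdot>\<^bsub>S\<^esub> b \<cdot>\<^bsub>S\<^esub> f)"

definition order_ideal :: "('a, 'm) ehresmann_scheme \<Rightarrow> 'a set \<Rightarrow> bool" where
  "order_ideal S Y \<longleftrightarrow> Y \<subseteq> carrier S \<and> (\<forall>a b. b \<in> Y \<and> nat_le S a b \<longrightarrow> a \<in> Y)"

definition ehresmann_congruence ::
  "('a, 'm) ehresmann_scheme \<Rightarrow> ('a \<times> 'a) set \<Rightarrow> bool" where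
  "ehresmann_congruence S r \<longleftrightarrow> equiv (carrier S) r \<and>
    (\<forall>(x, x') \<in> r. \<forall>(y, y') \<in> r. (x \<cdot>\<^bsub>S\<^esub> y, x' \<cdot>\<^bsub>S\<^esub> y') \<in> r) \<and>
    (\<forall>(x, x') \<in> r. (x\<^bsup>+\<^esup>\<^bsub>S\<^esub>, x'\<^bsup>+\<^esup>\<^bsub>S\<^esub>) \<in> r) \<and>
    (\<forall>(x, x') \<in> r. (x\<^bsup>*\<^esup>\<^bsub>S\<^esub>, x'\<^bsup>*\<^esup>\<^bsub>S\<^esub>) \<in> r)"

definition sigma :: "('a, 'm) ehresmann_scheme \<Rightarrow> ('a \<times> 'a) set" where
  "sigma S = \<Inter> {r. ehresmann_congruence S r \<and> projections S \<times> projections S \<subseteq> r}"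

lemma (in ehresmann_semigroup) sigma_minimum:
  "ehresmann_congruence S (sigma S)"
  "projections S \<times> projections S \<subseteq> sigma S"
  "\<lbrakk>ehresmann_congruence S r; projections S \<times> projections S \<subseteq> r\<rbrakk> \<Longrightarrow> sigma S \<subseteq> r"
proof -
  have top: "ehresmann_congruence S (carrier S \<times> carrier S)"
    unfolding ehresmann_congruence_def equiv_def refl_on_def sym_def trans_def
    using mult_closed plus_closed star_closed by auto
  have "projections S \<subseteq> carrier S"
    unfolding projections_def using plus_closed by auto
  with top have sub: "sigma S \<subseteq> carrier S \<times> carrier S"
    unfolding sigma_def by blast
  have "equiv (carrier S) (sigma S)"
  proof (rule equivI[OF sub])
    show "refl_on (carrier S) (sigma S)"
      unfolding sigma_def refl_on_def ehresmann_congruence_def equiv_def by simp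
    show "sym (sigma S)"
      unfolding sigma_def by (auto simp: sym_def ehresmann_congruence_def equiv_def)
    show "trans (sigma S)"
      unfolding sigma_def trans_def ehresmann_congruence_def equiv_def by blast
  qed
  moreover have "(x \<cdot> y, x' \<cdot> y') \<in> sigma S"
    if "(x, x') \<in> sigma S" "(y, y') \<in> sigma S" for x x' y y'
    unfolding sigma_def
  proof (rule InterI)
    fix r assume "r \<in> {r. ehresmann_congruence S r \<and> projections S \<times> projections S \<subseteq> r}"
    with that have "ehresmann_congruence S r" "(x, x') \<in> r" "(y, y') \<in> r"
      unfolding sigma_def by blast+
    then show "(x \<cdot> y, x' \<cdot> y') \<in> r"
      unfolding ehresmann_congruence_def by blast
  qed
  moreover have "(x\<^bsup>+\<^esup>, x'\<^bsup>+\<^esup>) \<in> sigma S \<and> (x\<^bsup>*\<^esup>, x'\<^bsup>*\<^esup>) \<in> sigma S"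
    if "(x, x') \<in> sigma S" for x x'
  proof -
    have "(x\<^bsup>+\<^esup>, x'\<^bsup>+\<^esup>) \<in> r \<and> (x\<^bsup>*\<^esup>, x'\<^bsup>*\<^esup>) \<in> r"
      if r: "ehresmann_congruence S r" "projections S \<times> projections S \<subseteq> r" for r
    proof -
      from \<open>(x, x') \<in> sigma S\<close> r have "(x, x') \<in> r"
        unfolding sigma_def by blast
      with r(1) show ?thesis
        unfolding ehresmann_congruence_def by blast
    qed
    then show ?thesis
      unfolding sigma_def by blast
  qed
  ultimately show "ehresmann_congruence S (sigma S)"
    unfolding ehresmann_congruence_def by blast
  show "projections S \<times> projections S \<subseteq> sigma S"
    unfolding sigma_def by blast
  show "\<lbrakk>ehresmann_congruence S r; projections S \<times> projections S \<subseteq> r\<rbrakk> \<Longrightarrow> sigma S \<subseteq> r"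
    unfolding sigma_def by blast
qed


section \<open>Proper Ehresmann semigroups\<close>

definition proper_element :: "('a, 'm) ehresmann_scheme \<Rightarrow> 'a \<Rightarrow> bool" where
  "proper_element S s \<longleftrightarrow> s \<in> carrier S \<and>
    (\<forall>t\<in>carrier S. t\<^bsup>+\<^esup>\<^bsub>S\<^esub> = s\<^bsup>+\<^esup>\<^bsub>S\<^esub> \<and> t\<^bsup>*\<^esup>\<^bsub>S\<^esub> = s\<^bsup>*\<^esup>\<^bsub>S\<^esub> \<and> (t, s) \<in> sigma S \<longrightarrow> t = s)"

text \<open>There is no empty product in a semigroup; \<open>sprod\<close> is only used on nonempty lists.\<close>

definition sprod :: "('a, 'm) ehresmann_scheme \<Rightarrow> 'a list \<Rightarrow> 'a" where
  "sprod S xs = foldl (\<lambda>x y. x \<cdot>\<^bsub>S\<^esub> y) (hd xs) (tl xs)"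

definition matching_factorization ::
  "('a, 'm) ehresmann_scheme \<Rightarrow> 'a \<Rightarrow> 'a list \<Rightarrow> bool" where
  "matching_factorization S s xs \<longleftrightarrow> xs \<noteq> [] \<and> set xs \<subseteq> carrier S \<and> s = sprod S xs \<and>
    successively (\<lambda>x y. x\<^bsup>*\<^esup>\<^bsub>S\<^esub> = y\<^bsup>+\<^esup>\<^bsub>S\<^esub>) xs"

definition factorization_into ::
  "('a, 'm) ehresmann_scheme \<Rightarrow> 'a set \<Rightarrow> 'a \<Rightarrow> 'a list \<Rightarrow> bool" where
  "factorization_into S Y s xs \<longleftrightarrow> matching_factorization S s xs \<and> set xs \<subseteq> Y"

definition reduces ::
  "('a, 'm) ehresmann_scheme \<Rightarrow> 'a \<Rightarrow> 'a list \<Rightarrow> 'a list \<Rightarrow> bool" where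
  "reduces S s xs ys \<longleftrightarrow> factorization_into S {x. proper_element S x} s xs \<and>
    (\<exists>us vs ws. vs \<noteq> [] \<and> xs = us @ vs @ ws \<and> proper_element S (sprod S vs) \<and>
      ys = us @ [sprod S vs] @ ws)"

text \<open>The intermediate factorizations witnessing equivalence are into products of arbitrary
  proper elements; they need not be into products of elements of the order ideal.\<close>

definition factorizations_equivalent ::
  "('a, 'm) ehresmann_scheme \<Rightarrow> 'a \<Rightarrow> 'a list \<Rightarrow> 'a list \<Rightarrow> bool" where
  "factorizations_equivalent S s = equivclp (reduces S s)"

definition proper_ehresmann_semigroup :: "('a, 'm) ehresmann_scheme \<Rightarrow> bool" where
  "proper_ehresmann_semigroup S \<longleftrightarrow> ehresmann_semigroup S \<and>
    (\<exists>Y. order_ideal S Y \<and> projections S \<subseteq> Y \<and> (\<forall>y\<in>Y. proper_element S y) \<and>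
      (\<forall>s\<in>carrier S. (\<exists>xs. factorization_into S Y s xs) \<and>
        (\<forall>xs ys. factorization_into S Y s xs \<and> factorization_into S Y s ys \<longrightarrow>
          factorizations_equivalent S s xs ys)))"

definition proper_cover ::
  "('a, 'm) ehresmann_scheme \<Rightarrow> ('b, 'n) ehresmann_scheme \<Rightarrow> ('a \<Rightarrow> 'b) \<Rightarrow> bool" where
  "proper_cover Q S \<phi> \<longleftrightarrow> proper_ehresmann_semigroup Q \<and> ehresmann_hom Q S \<phi> \<and>
    \<phi> ` carrier Q = carrier S \<and> projection_separating Q \<phi>"

end

theory Submission
  imports Defs
begin

text \<open>
  The cover is built by unfolding products of \<open>S\<close> into paths, just as a free monoid unfolds
  products into words.  A path \<open>[e\<^sub>0, x\<^sub>1, e\<^sub>1, \<dots>, x\<^sub>n, e\<^sub>n]\<close> alternates between projections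
  (vertices) and arbitrary elements of \<open>S\<close> (labels), and its vertices are tight: the element
  \<open>e\<^sub>i\<^sub>-\<^sub>1 x\<^sub>i e\<^sub>i\<close> has plus \<open>e\<^sub>i\<^sub>-\<^sub>1\<close> and star \<open>e\<^sub>i\<close>.  Paths form a category under gluing.  A projection
  acts on a path from the left by shrinking the first vertex and propagating the loss to the
  right (\<open>restriction\<close>), and from the right in the mirror-image way (\<open>corestriction\<close>).  The product
  of two paths first shrinks both of them until the end of one is the start of the other, and then
  glues.  The two actions commute (\<open>restriction_corestriction\<close>) and distribute over gluing
  (\<open>restriction_glue\<close>, \<open>corestriction_glue\<close>); this gives associativity
  (\<open>path_mult_assoc\<close>), and the other Ehresmann identities are then easy.  Multiplying out a path is
  a morphism \<open>realize\<close> onto \<open>S\<close>, since \<open>s\<close> is the value of \<open>[s\<^sup>+, s, s\<^sup>*]\<close>; projections of the cover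
  are the one-vertex paths, so the morphism separates them.

  The cover is proper because the word of labels is invariant under \<open>\<sigma>\<close>: reading off the labels is
  a morphism to a free monoid and kills all projections.  Hence a path with at most one edge is a
  proper element, being determined by its end vertices and its label.  These short paths form the
  required order ideal \<open>Y\<close>.  A matching product of paths is just their gluing, so every
  factorization into \<open>Y\<close> lists the edges of the path, possibly interspersed with one-vertex
  paths; the latter can be merged into a neighbour, which leaves a canonical factorization
  (\<open>factorizations_equivalent_edges\<close>).
\<close>

section \<open>Projections and matching factorizations\<close>

context ehresmann_semigroup
begin

abbreviation P :: "'a set" where "P \<equiv> projections S"

declare mult_closed [simp] plus_closed [simp] star_closed [simp]

lemma plus_in_P [simp]: "x \<in> carrier S \<Longrightarrow> x\<^bsup>+\<^esup> \<in> P"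
  unfolding projections_def by blast

lemma star_in_P [simp]: "x \<in> carrier S \<Longrightarrow> x\<^bsup>*\<^esup> \<in> P"
  unfolding projections_eq_star by blast

lemma P_carrier [simp]: "e \<in> P \<Longrightarrow> e \<in> carrier S"
  unfolding projections_def by auto

lemma P_star [simp]: "e \<in> P \<Longrightarrow> e\<^bsup>*\<^esup> = e"
  unfolding projections_def by (auto simp: star_of_plus)

lemma P_plus [simp]: "e \<in> P \<Longrightarrow> e\<^bsup>+\<^esup> = e"
  unfolding projections_eq_star by (auto simp: plus_of_star)

lemma P_idem [simp]: "e \<in> P \<Longrightarrow> e \<cdot> e = e"
  using plus_mult[of e] by simp

lemma P_comm: "e \<in> P \<Longrightarrow> f \<in> P \<Longrightarrow> e \<cdot> f = f \<cdot> e"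
  using plus_comm[of e f] by simp

lemma P_mult [simp]: "e \<in> P \<Longrightarrow> f \<in> P \<Longrightarrow> e \<cdot> f \<in> P"
  using plus_mult_plus[of e f] plus_in_P[of "e \<cdot> f"] by simp

lemma P_left_idem [simp]: "e \<in> P \<Longrightarrow> x \<in> carrier S \<Longrightarrow> e \<cdot> (e \<cdot> x) = e \<cdot> x"
  by (simp flip: mult_assoc)

lemma P_left_comm: "e \<in> P \<Longrightarrow> f \<in> P \<Longrightarrow> x \<in> carrier S \<Longrightarrow> e \<cdot> (f \<cdot> x) = f \<cdot> (e \<cdot> x)"
  by (simp add: P_comm[of e f] flip: mult_assoc)

lemma plus_P_mult: "e \<in> P \<Longrightarrow> x \<in> carrier S \<Longrightarrow> (e \<cdot> x)\<^bsup>+\<^esup> = e \<cdot> x\<^bsup>+\<^esup>"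
  by (simp add: plus_of_mult[of e x])

lemma star_mult_P: "x \<in> carrier S \<Longrightarrow> f \<in> P \<Longrightarrow> (x \<cdot> f)\<^bsup>*\<^esup> = x\<^bsup>*\<^esup> \<cdot> f"
  by (simp add: star_of_mult[of x f])

lemma mult_star_mult: "x \<in> carrier S \<Longrightarrow> y \<in> carrier S \<Longrightarrow> x \<cdot> (x\<^bsup>*\<^esup> \<cdot> y) = x \<cdot> y"
  by (simp add: mult_star flip: mult_assoc)

lemma plus_mult_mult: "x \<in> carrier S \<Longrightarrow> y \<in> carrier S \<Longrightarrow> (x \<cdot> y)\<^bsup>+\<^esup> \<cdot> x\<^bsup>+\<^esup> = (x \<cdot> y)\<^bsup>+\<^esup>"
  using plus_P_mult[of "x\<^bsup>+\<^esup>" "x \<cdot> y"] P_comm[of "(x \<cdot> y)\<^bsup>+\<^esup>" "x\<^bsup>+\<^esup>"]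
  by (simp add: plus_mult flip: mult_assoc)

lemma star_mult_mult: "x \<in> carrier S \<Longrightarrow> y \<in> carrier S \<Longrightarrow> (x \<cdot> y)\<^bsup>*\<^esup> \<cdot> y\<^bsup>*\<^esup> = (x \<cdot> y)\<^bsup>*\<^esup>"
  using star_mult_P[of "x \<cdot> y" "y\<^bsup>*\<^esup>"] by (simp add: mult_star mult_assoc)

text \<open>Along a matching factorization the plus of a product is that of its first factor.  Hence a
  matching condition with the first factor is one with the whole product, which makes
  factorizations accessible to induction (\<open>factorization_Cons\<close>, \<open>reduces_Cons\<close>).\<close>

lemma plus_matching:
  "x \<in> carrier S \<Longrightarrow> y \<in> carrier S \<Longrightarrow> x\<^bsup>*\<^esup> = y\<^bsup>+\<^esup> \<Longrightarrow> (x \<cdot> y)\<^bsup>+\<^esup> = x\<^bsup>+\<^esup>"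
  by (metis plus_of_mult mult_star)

lemma sprod_singleton [simp]: "sprod S [x] = x"
  by (simp add: sprod_def)

lemma sprod_Cons:
  assumes "x \<in> carrier S" "set xs \<subseteq> carrier S" "xs \<noteq> []"
  shows "sprod S (x # xs) = x \<cdot> sprod S xs"
proof -
  have "foldl (\<lambda>x y. x \<cdot> y) (x \<cdot> y) zs = x \<cdot> foldl (\<lambda>x y. x \<cdot> y) y zs"
    if "y \<in> carrier S" "set zs \<subseteq> carrier S" for y zs
    using that assms(1) by (induction zs arbitrary: y) (auto simp: mult_assoc)
  with assms show ?thesis
    by (cases xs) (auto simp: sprod_def)
qed

lemma sprod_closed: "xs \<noteq> [] \<Longrightarrow> set xs \<subseteq> carrier S \<Longrightarrow> sprod S xs \<in> carrier S"
  by (induction xs rule: list_nonempty_induct) (auto simp: sprod_Cons)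

lemma plus_sprod:
  assumes "xs \<noteq> []" "set xs \<subseteq> carrier S" "successively (\<lambda>x y. x\<^bsup>*\<^esup> = y\<^bsup>+\<^esup>) xs"
  shows "(sprod S xs)\<^bsup>+\<^esup> = (hd xs)\<^bsup>+\<^esup>"
  using assms
  by (induction xs rule: list_nonempty_induct)
    (auto simp: sprod_Cons successively_Cons sprod_closed intro: plus_matching)

lemma factorization_singleton:
  "factorization_into S Y s [x] \<longleftrightarrow> x \<in> carrier S \<and> x \<in> Y \<and> s = x"
  by (auto simp: factorization_into_def matching_factorization_def)

lemma factorization_Cons:
  assumes "xs \<noteq> []"
  shows "factorization_into S Y s (x # xs) \<longleftrightarrow> x \<in> carrier S \<and> x \<in> Y \<and>
    (\<exists>t. factorization_into S Y t xs \<and> x\<^bsup>*\<^esup> = t\<^bsup>+\<^esup> \<and> s = x \<cdot> t)"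
  using assms plus_sprod[of xs]
  by (auto simp: factorization_into_def matching_factorization_def successively_Cons sprod_Cons)

lemma reduces_Cons:
  assumes "reduces S t xs ys" "proper_element S y" "y\<^bsup>*\<^esup> = t\<^bsup>+\<^esup>"
  shows "reduces S (y \<cdot> t) (y # xs) (y # ys)"
proof -
  have y: "y \<in> carrier S"
    using assms(2) by (simp add: proper_element_def)
  from assms(1) obtain us vs ws where *: "factorization_into S {x. proper_element S x} t xs"
    "vs \<noteq> []" "xs = us @ vs @ ws" "proper_element S (sprod S vs)" "ys = us @ [sprod S vs] @ ws"
    unfolding reduces_def by blast
  have "factorization_into S {x. proper_element S x} (y \<cdot> t) (y # xs)"
    using * assms y by (subst factorization_Cons) auto
  with * show ?thesis
    unfolding reduces_def by (metis append_Cons)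
qed

lemma factorizations_equivalent_Cons:
  assumes "factorizations_equivalent S t xs ys" "proper_element S y" "y\<^bsup>*\<^esup> = t\<^bsup>+\<^esup>"
  shows "factorizations_equivalent S (y \<cdot> t) (y # xs) (y # ys)"
  using assms(1) unfolding factorizations_equivalent_def
proof (induction rule: equivclp_induct)
  case base
  show ?case by simp
next
  case (step zs ws)
  from step(2) have "reduces S (y \<cdot> t) (y # zs) (y # ws) \<or> reduces S (y \<cdot> t) (y # ws) (y # zs)"
    using reduces_Cons assms(2,3) by blast
  with step(3) show ?case
    by (blast intro: equivclp_trans r_into_equivclp converse_r_into_equivclp)
qed

section \<open>Paths\<close>

text \<open>For a projection \<open>e\<close> and \<open>f = hd p\<close> the two equations say \<open>e \<le> (x f)\<^sup>+\<close> and \<open>f \<le> (e x)\<^sup>*\<close>, that is,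
  the element \<open>e x f\<close> has plus \<open>e\<close> and star \<open>f\<close>.  Keeping the label \<open>x\<close> rather than \<open>e x f\<close> makes the
  labels invariant under the actions of projections.\<close>

fun path :: "'a list \<Rightarrow> bool" where
  "path [] \<longleftrightarrow> False"
| "path [e] \<longleftrightarrow> e \<in> P"
| "path (e # x # p) \<longleftrightarrow> e \<in> P \<and> x \<in> carrier S \<and> path p \<and>
     e \<cdot> (x \<cdot> hd p)\<^bsup>+\<^esup> = e \<and> (e \<cdot> x)\<^bsup>*\<^esup> \<cdot> hd p = hd p"

fun labels :: "'a list \<Rightarrow> 'a list" where
  "labels (e # x # p) = x # labels p"
| "labels p = []"

fun realize :: "'a list \<Rightarrow> 'a" where
  "realize (e # x # p) = e \<cdot> x \<cdot> realize p"
| "realize p = hd p"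

text \<open>After \<open>e\<close> has shrunk to \<open>g e\<close>, the edge labelled \<open>x\<close> only reaches the part of the next vertex
  below \<open>(g e x)\<^sup>*\<close>.  The second equation is meant for one-vertex paths.\<close>

fun restriction :: "'a \<Rightarrow> 'a list \<Rightarrow> 'a list" where
  "restriction g (e # x # p) = (g \<cdot> e) # x # restriction ((g \<cdot> e \<cdot> x)\<^bsup>*\<^esup>) p"
| "restriction g p = map (\<lambda>e. g \<cdot> e) p"

text \<open>The mirror image of \<open>restriction\<close>: the tail is shrunk first, and its new first vertex limits \<open>e\<close>.\<close>

fun corestriction :: "'a list \<Rightarrow> 'a \<Rightarrow> 'a list" where
  "corestriction (e # x # p) g = (e \<cdot> (x \<cdot> hd (corestriction p g))\<^bsup>+\<^esup>) # x # corestriction p g"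
| "corestriction p g = map (\<lambda>e. e \<cdot> g) p"

definition glue :: "'a list \<Rightarrow> 'a list \<Rightarrow> 'a list" where
  "glue p q = butlast p @ q"

lemma path_nonempty [simp]: "path p \<Longrightarrow> p \<noteq> []"
  by auto

lemma path_induct [consumes 1, case_names vertex edge]:
  assumes "path p"
    and "\<And>e. e \<in> P \<Longrightarrow> Q [e]"
    and "\<And>e x p. path (e # x # p) \<Longrightarrow> path p \<Longrightarrow> Q p \<Longrightarrow> Q (e # x # p)"
  shows "Q p"
  using assms(1) by (induction p rule: path.induct) (auto intro: assms(2,3))

lemma path_hd [simp]: "path p \<Longrightarrow> hd p \<in> P"
  by (induction rule: path_induct) auto

lemma path_last [simp]: "path p \<Longrightarrow> last p \<in> P"
  by (induction rule: path_induct) auto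

lemma hd_restriction [simp]: "path p \<Longrightarrow> hd (restriction g p) = g \<cdot> hd p"
  by (cases p rule: path.cases) auto

lemma path_restriction [simp]: "path p \<Longrightarrow> g \<in> P \<Longrightarrow> path (restriction g p)"
proof (induction arbitrary: g rule: path_induct)
  case (vertex e)
  then show ?case by simp
next
  case (edge e x p)
  let ?h = "(g \<cdot> e \<cdot> x)\<^bsup>*\<^esup>"
  have m: "e \<in> P" "x \<in> carrier S" "hd p \<in> P" "g \<in> P"
    and e: "e \<cdot> (x \<cdot> hd p)\<^bsup>+\<^esup> = e"
    using edge by auto
  have "g \<cdot> e \<cdot> (x \<cdot> (?h \<cdot> hd p))\<^bsup>+\<^esup> = (g \<cdot> e \<cdot> x \<cdot> (?h \<cdot> hd p))\<^bsup>+\<^esup>"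
    using m plus_P_mult[of "g \<cdot> e" "x \<cdot> (?h \<cdot> hd p)"] by (simp add: mult_assoc)
  also have "\<dots> = (g \<cdot> e \<cdot> (x \<cdot> hd p))\<^bsup>+\<^esup>"
    using m mult_star_mult[of "g \<cdot> e \<cdot> x" "hd p"] by (simp add: mult_assoc)
  also have "\<dots> = g \<cdot> e"
    using m e plus_P_mult[of "g \<cdot> e" "x \<cdot> hd p"] by (simp add: mult_assoc)
  finally show ?case
    using edge m by simp
qed

lemma hd_corestriction_le [simp]:
  "path p \<Longrightarrow> g \<in> P \<Longrightarrow> path (corestriction p g) \<Longrightarrow>
    hd p \<cdot> hd (corestriction p g) = hd (corestriction p g)"
  by (cases p rule: path.cases) auto

text \<open>Shrinking the target of an edge to \<open>k\<close>, and its source accordingly, leaves \<open>k\<close> reachable: the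
  projection \<open>(x k)\<^sup>+\<close> is absorbed by \<open>x k\<close>.\<close>

lemma corestriction_edge:
  assumes "e \<in> P" "x \<in> carrier S" "f \<in> P" "k \<in> P" "f \<cdot> k = k" "(e \<cdot> x)\<^bsup>*\<^esup> \<cdot> f = f"
  shows "(e \<cdot> (x \<cdot> k)\<^bsup>+\<^esup> \<cdot> x)\<^bsup>*\<^esup> \<cdot> k = k"
proof -
  have "(e \<cdot> (x \<cdot> k)\<^bsup>+\<^esup> \<cdot> x)\<^bsup>*\<^esup> \<cdot> k = (e \<cdot> ((x \<cdot> k)\<^bsup>+\<^esup> \<cdot> (x \<cdot> k)))\<^bsup>*\<^esup>"
    using assms star_mult_P[of "e \<cdot> (x \<cdot> k)\<^bsup>+\<^esup> \<cdot> x" k] by (simp add: mult_assoc)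
  also have "\<dots> = (e \<cdot> x)\<^bsup>*\<^esup> \<cdot> k"
    using assms star_mult_P[of "e \<cdot> x" k] by (simp add: mult_assoc plus_mult)
  also have "\<dots> = k"
    using assms mult_assoc[of "(e \<cdot> x)\<^bsup>*\<^esup>" f k] by simp
  finally show ?thesis .
qed

lemma path_corestriction [simp]: "path p \<Longrightarrow> g \<in> P \<Longrightarrow> path (corestriction p g)"
proof (induction rule: path_induct)
  case (edge e x p)
  let ?k = "hd (corestriction p g)"
  have "hd p \<cdot> ?k = ?k" "?k \<in> P"
    using edge by auto
  then show ?case
    using edge corestriction_edge[of e x "hd p" ?k] by (simp add: mult_assoc)
qed simp

lemma restriction_eq_Nil [simp]: "restriction g p = [] \<longleftrightarrow> p = []"
  by (cases "(g, p)" rule: restriction.cases) auto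

lemma corestriction_eq_Nil [simp]: "corestriction p g = [] \<longleftrightarrow> p = []"
  by (cases "(p, g)" rule: corestriction.cases) auto

lemma length_restriction [simp]: "length (restriction g p) = length p"
  by (induction g p rule: restriction.induct) auto

lemma length_corestriction [simp]: "length (corestriction p g) = length p"
  by (induction p g rule: corestriction.induct) auto

lemma labels_restriction [simp]: "labels (restriction g p) = labels p"
  by (induction g p rule: restriction.induct) auto

lemma labels_corestriction [simp]: "labels (corestriction p g) = labels p"
  by (induction p g rule: corestriction.induct) auto

lemma last_corestriction [simp]: "path p \<Longrightarrow> last (corestriction p g) = last p \<cdot> g"
  by (induction rule: path_induct) auto

lemma last_restriction_le: "path p \<Longrightarrow> g \<in> P \<Longrightarrow> last p \<cdot> last (restriction g p) = last (restriction g p)"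
  by (induction arbitrary: g rule: path_induct) (auto simp: P_left_comm P_comm)

text \<open>Only the meet of the acting projection with the first vertex matters.  This is how comparisons
  of two restrictions are reduced to semilattice identities below.\<close>

lemma restriction_cong:
  "path p \<Longrightarrow> g \<cdot> hd p = h \<cdot> hd p \<Longrightarrow> restriction g p = restriction h p"
  by (cases p rule: path.cases) auto

lemma restriction_hd: "path p \<Longrightarrow> restriction (hd p) p = p"
proof (induction rule: path_induct)
  case (edge e x p)
  then have "restriction ((e \<cdot> x)\<^bsup>*\<^esup>) p = restriction (hd p) p"
    by (intro restriction_cong) auto
  with edge show ?case by simp
qed simp

lemma corestriction_last: "path p \<Longrightarrow> corestriction p (last p) = p"
  by (induction rule: path_induct) auto

lemma restriction_restriction:
  "path p \<Longrightarrow> g \<in> P \<Longrightarrow> h \<in> P \<Longrightarrow> restriction g (restriction h p) = restriction (g \<cdot> h) p"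
proof (induction arbitrary: g h rule: path_induct)
  case (edge e x p)
  then have "(g \<cdot> (h \<cdot> (e \<cdot> x)))\<^bsup>*\<^esup> \<cdot> (h \<cdot> (e \<cdot> x))\<^bsup>*\<^esup> = (g \<cdot> (h \<cdot> (e \<cdot> x)))\<^bsup>*\<^esup>"
    by (intro star_mult_mult) auto
  with edge show ?case by (simp add: mult_assoc)
qed (simp add: mult_assoc)

lemma plus_mult_P_antimono:
  assumes "x \<in> carrier S" "e \<in> P" "f \<in> P" "e \<cdot> f = f"
  shows "(x \<cdot> e)\<^bsup>+\<^esup> \<cdot> (x \<cdot> f)\<^bsup>+\<^esup> = (x \<cdot> f)\<^bsup>+\<^esup>"
  using assms plus_mult_mult[of "x \<cdot> e" f] P_comm[of "(x \<cdot> e)\<^bsup>+\<^esup>" "(x \<cdot> f)\<^bsup>+\<^esup>"]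
  by (simp add: mult_assoc)

text \<open>The second corestriction shrinks each vertex further, and \<open>(x k)\<^sup>+\<close> is monotone in \<open>k\<close>, so the
  factor contributed by the first one is absorbed.\<close>

lemma corestriction_corestriction:
  "path p \<Longrightarrow> g \<in> P \<Longrightarrow> h \<in> P \<Longrightarrow> corestriction (corestriction p g) h = corestriction p (g \<cdot> h)"
proof (induction rule: path_induct)
  case (edge e x p)
  then have "hd (corestriction p g) \<cdot> hd (corestriction p (g \<cdot> h)) = hd (corestriction p (g \<cdot> h))"
    using hd_corestriction_le[of "corestriction p g" h] by simp
  with edge show ?case by (simp add: mult_assoc plus_mult_P_antimono)
qed (simp add: mult_assoc)

lemma corestriction_cong:
  assumes "path p" "g \<in> P" "h \<in> P" "last p \<cdot> g = last p \<cdot> h"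
  shows "corestriction p g = corestriction p h"
  using assms corestriction_corestriction[of p "last p" g] corestriction_corestriction[of p "last p" h]
  by (simp add: corestriction_last)

text \<open>At each vertex the restriction contributes the star of the product read so far and the
  corestriction the plus of the product still to be read.  Each of these sees the other
  contribution only through a product that absorbs it, by \<open>x x\<^sup>* = x\<close> or \<open>x\<^sup>+ x = x\<close>.\<close>

lemma restriction_corestriction:
  "path p \<Longrightarrow> g \<in> P \<Longrightarrow> h \<in> P \<Longrightarrow> restriction g (corestriction p h) = corestriction (restriction g p) h"
proof (induction arbitrary: g rule: path_induct)
  case (edge e x p)
  let ?k = "hd (corestriction p h)" and ?y = "g \<cdot> e \<cdot> x"
  have m: "e \<in> P" "x \<in> carrier S" "?k \<in> P" "g \<in> P" "path (corestriction p h)"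
    using edge by auto
  have IH: "corestriction (restriction (?y\<^bsup>*\<^esup>) p) h = restriction (?y\<^bsup>*\<^esup>) (corestriction p h)"
    using edge m by simp
  have "g \<cdot> e \<cdot> (x \<cdot> (?y\<^bsup>*\<^esup> \<cdot> ?k))\<^bsup>+\<^esup> = (?y \<cdot> (?y\<^bsup>*\<^esup> \<cdot> ?k))\<^bsup>+\<^esup>"
    using m plus_P_mult[of "g \<cdot> e" "x \<cdot> (?y\<^bsup>*\<^esup> \<cdot> ?k)"] by (simp add: mult_assoc)
  also have "\<dots> = g \<cdot> e \<cdot> (x \<cdot> ?k)\<^bsup>+\<^esup>"
    using m plus_P_mult[of "g \<cdot> e" "x \<cdot> ?k"] mult_star_mult[of ?y ?k] by (simp add: mult_assoc)
  finally have head: "g \<cdot> e \<cdot> (x \<cdot> (?y\<^bsup>*\<^esup> \<cdot> ?k))\<^bsup>+\<^esup> = g \<cdot> e \<cdot> (x \<cdot> ?k)\<^bsup>+\<^esup>" .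
  have "(g \<cdot> (e \<cdot> (x \<cdot> ?k)\<^bsup>+\<^esup>) \<cdot> x)\<^bsup>*\<^esup> \<cdot> ?k = (g \<cdot> e \<cdot> ((x \<cdot> ?k)\<^bsup>+\<^esup> \<cdot> (x \<cdot> ?k)))\<^bsup>*\<^esup>"
    using m star_mult_P[of "g \<cdot> (e \<cdot> (x \<cdot> ?k)\<^bsup>+\<^esup>) \<cdot> x" ?k] by (simp add: mult_assoc)
  also have "\<dots> = ?y\<^bsup>*\<^esup> \<cdot> ?k"
    using m star_mult_P[of ?y ?k] by (simp add: plus_mult mult_assoc)
  finally have "restriction ((g \<cdot> (e \<cdot> (x \<cdot> ?k)\<^bsup>+\<^esup>) \<cdot> x)\<^bsup>*\<^esup>) (corestriction p h)
      = restriction (?y\<^bsup>*\<^esup>) (corestriction p h)"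
    using m by (intro restriction_cong)
  with head IH m show ?case by (simp add: mult_assoc)
qed (simp add: mult_assoc)

lemma glue_vertex [simp]: "glue [e] q = q"
  by (simp add: glue_def)

lemma glue_edge [simp]: "p \<noteq> [] \<Longrightarrow> glue (e # x # p) q = e # x # glue p q"
  by (simp add: glue_def)

lemma glue_last: "p \<noteq> [] \<Longrightarrow> glue p [last p] = p"
  by (simp add: glue_def)

lemma glue_assoc: "q \<noteq> [] \<Longrightarrow> glue (glue p q) r = glue p (glue q r)"
  by (simp add: glue_def butlast_append)

lemma last_glue [simp]: "q \<noteq> [] \<Longrightarrow> last (glue p q) = last q"
  by (simp add: glue_def)

lemma hd_glue [simp]: "path p \<Longrightarrow> last p = hd q \<Longrightarrow> hd (glue p q) = hd p"
  by (induction rule: path_induct) auto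

lemma path_glue [simp]: "path p \<Longrightarrow> path q \<Longrightarrow> last p = hd q \<Longrightarrow> path (glue p q)"
  by (induction rule: path_induct) auto

lemma labels_glue [simp]: "path p \<Longrightarrow> labels (glue p q) = labels p @ labels q"
  by (induction rule: path_induct) auto

text \<open>Restriction propagates to the right, so what reaches the second path is the last vertex of the
  restricted first path; dually for corestriction.\<close>

lemma restriction_glue:
  assumes "path p" "path q" "last p = hd q" "g \<in> P"
  shows "restriction g (glue p q) = glue (restriction g p) (restriction (last (restriction g p)) q)"
  using assms
proof (induction arbitrary: g rule: path_induct)
  case (vertex e)
  then show ?case
    by (auto intro!: restriction_cong simp: mult_assoc)
qed auto

lemma corestriction_glue:
  assumes "path p" "path q" "last p = hd q" "g \<in> P"
  shows "corestriction (glue p q) g = glue (corestriction p (hd (corestriction q g))) (corestriction q g)"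
  using assms
proof (induction rule: path_induct)
  case (edge e x p)
  then have "last (corestriction p (hd (corestriction q g))) = hd (corestriction q g)"
    by (simp add: hd_corestriction_le)
  with edge show ?case by simp
qed auto

lemma realize_closed [simp]: "path p \<Longrightarrow> realize p \<in> carrier S"
  by (induction rule: path_induct) auto

lemma realize_hd: "path p \<Longrightarrow> hd p \<cdot> realize p = realize p"
  by (induction rule: path_induct) (auto simp: mult_assoc)

lemma realize_restriction: "path p \<Longrightarrow> g \<in> P \<Longrightarrow> realize (restriction g p) = g \<cdot> realize p"
proof (induction arbitrary: g rule: path_induct)
  case (edge e x p)
  then show ?case
    using mult_star_mult[of "g \<cdot> e \<cdot> x" "realize p"] by (simp add: mult_assoc)
qed simp

lemma realize_corestriction: "path p \<Longrightarrow> g \<in> P \<Longrightarrow> realize (corestriction p g) = realize p \<cdot> g"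
proof (induction rule: path_induct)
  case (edge e x p)
  let ?k = "hd (corestriction p g)" and ?r = "realize (corestriction p g)"
  have m: "e \<in> P" "x \<in> carrier S" "?k \<in> P" "?r \<in> carrier S"
    using edge by auto
  have r: "?k \<cdot> ?r = ?r"
    using edge by (intro realize_hd) auto
  have "(x \<cdot> ?k)\<^bsup>+\<^esup> \<cdot> (x \<cdot> ?r) = (x \<cdot> ?k)\<^bsup>+\<^esup> \<cdot> (x \<cdot> ?k) \<cdot> ?r"
    using m r by (simp add: mult_assoc)
  also have "\<dots> = x \<cdot> ?r"
    using m r plus_mult[of "x \<cdot> ?k"] by (simp add: mult_assoc)
  finally show ?case
    using edge m by (simp add: mult_assoc)
qed simp

lemma realize_glue:
  "path p \<Longrightarrow> path q \<Longrightarrow> last p = hd q \<Longrightarrow> realize (glue p q) = realize p \<cdot> realize q"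
  by (induction rule: path_induct) (auto simp: mult_assoc realize_hd)

lemma plus_realize: "path p \<Longrightarrow> (realize p)\<^bsup>+\<^esup> = hd p"
proof (induction rule: path_induct)
  case (edge e x p)
  then show ?case
    using plus_of_mult[of "e \<cdot> x" "realize p"] plus_P_mult[of e "x \<cdot> hd p"] by (simp add: mult_assoc)
qed simp

lemma star_realize: "path p \<Longrightarrow> (realize p)\<^bsup>*\<^esup> = last p"
proof (induction rule: path_induct)
  case (edge e x p)
  have "(realize (e # x # p))\<^bsup>*\<^esup> = ((e \<cdot> x)\<^bsup>*\<^esup> \<cdot> (hd p \<cdot> realize p))\<^bsup>*\<^esup>"
    using edge star_of_mult[of "e \<cdot> x" "realize p"] by (simp add: realize_hd)
  also have "\<dots> = last p"
    using edge mult_assoc[of "(e \<cdot> x)\<^bsup>*\<^esup>" "hd p" "realize p"] by (simp add: realize_hd)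
  finally show ?case using edge by simp
qed simp

section \<open>The Ehresmann semigroup of paths\<close>

definition path_mult :: "'a list \<Rightarrow> 'a list \<Rightarrow> 'a list" where
  "path_mult p q = glue (corestriction p (hd q)) (restriction (last p) q)"

definition cover :: "'a list ehresmann" where
  "cover = \<lparr>carrier = {p. path p}, mult = path_mult,
     plus_op = (\<lambda>p. [hd p]), star_op = (\<lambda>p. [last p])\<rparr>"

lemma cover_simps [simp]:
  "carrier cover = {p. path p}"
  "p \<cdot>\<^bsub>cover\<^esub> q = path_mult p q"
  "p\<^bsup>+\<^esup>\<^bsub>cover\<^esub> = [hd p]"
  "p\<^bsup>*\<^esup>\<^bsub>cover\<^esub> = [last p]"
  by (simp_all add: cover_def)

lemma path_mult_path [simp]: "path p \<Longrightarrow> path q \<Longrightarrow> path (path_mult p q)"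
  by (simp add: path_mult_def)

lemma hd_path_mult: "path p \<Longrightarrow> path q \<Longrightarrow> hd (path_mult p q) = hd (corestriction p (hd q))"
  by (simp add: path_mult_def)

lemma last_path_mult: "path p \<Longrightarrow> path q \<Longrightarrow> last (path_mult p q) = last (restriction (last p) q)"
  by (simp add: path_mult_def)

lemma labels_path_mult [simp]:
  "path p \<Longrightarrow> path q \<Longrightarrow> labels (path_mult p q) = labels p @ labels q"
  by (simp add: path_mult_def)

lemma vertex_mult [simp]: "path p \<Longrightarrow> path_mult [e] p = restriction e p"
  by (simp add: path_mult_def)

lemma mult_vertex [simp]: "path p \<Longrightarrow> f \<in> P \<Longrightarrow> path_mult p [f] = corestriction p f"
  using glue_last[of "corestriction p f"] by (simp add: path_mult_def)

lemma path_mult_matching: "path p \<Longrightarrow> path q \<Longrightarrow> last p = hd q \<Longrightarrow> path_mult p q = glue p q"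
  by (metis path_mult_def corestriction_last restriction_hd)

text \<open>Both bracketings are the gluing of three paths: \<open>q\<close> shrunk from both sides, \<open>p\<close> shrunk to the
  start of \<open>q\<close> as seen by \<open>r\<close>, and \<open>r\<close> shrunk to the end of \<open>q\<close> as seen by \<open>p\<close>.\<close>

lemma path_mult_assoc:
  assumes "path p" "path q" "path r"
  shows "path_mult (path_mult p q) r = path_mult p (path_mult q r)"
proof -
  let ?m = "restriction (last p) (corestriction q (hd r))"
  let ?k = "hd (corestriction q (hd r))" and ?l = "last (restriction (last p) q)"
  have k: "?k \<in> P" "hd q \<cdot> ?k = ?k" and l: "?l \<in> P" "last q \<cdot> ?l = ?l"
    using assms by (auto simp: hd_corestriction_le last_restriction_le)
  \<comment> \<open>The middle factor is the same for both bracketings because the actions commute.\<close>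
  have m: "?m = corestriction (restriction (last p) q) (hd r)"
    using assms by (simp add: restriction_corestriction)
  have "path_mult (path_mult p q) r = glue (corestriction (path_mult p q) (hd r)) (restriction ?l r)"
    using assms by (simp add: path_mult_def[of "path_mult p q"] last_path_mult)
  also have "corestriction (path_mult p q) (hd r)
      = glue (corestriction (corestriction p (hd q)) (hd ?m)) ?m"
    unfolding m using assms by (simp add: path_mult_def corestriction_glue)
  also have "corestriction (corestriction p (hd q)) (hd ?m) = corestriction p ?k"
    using assms k
    by (subst corestriction_corestriction) (auto intro!: corestriction_cong simp: P_left_comm)
  finally have 1: "path_mult (path_mult p q) r
      = glue (glue (corestriction p ?k) ?m) (restriction ?l r)" .
  have "path_mult p (path_mult q r) = glue (corestriction p ?k) (restriction (last p) (path_mult q r))"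
    using assms by (simp add: path_mult_def[of p "path_mult q r"] hd_path_mult)
  also have "restriction (last p) (path_mult q r)
      = glue ?m (restriction (last ?m) (restriction (last q) r))"
    using assms by (simp add: path_mult_def restriction_glue)
  also have "restriction (last ?m) (restriction (last q) r) = restriction ?l r"
    unfolding m using assms l P_left_comm[of "last q" "hd r" ?l]
    by (subst restriction_restriction)
      (auto intro!: restriction_cong simp: P_comm P_left_comm mult_assoc)
  finally show ?thesis
    using 1 assms by (simp add: glue_assoc)
qed

lemma ehresmann_cover: "ehresmann_semigroup cover"
proof
  fix p q assume "p \<in> carrier cover" "q \<in> carrier cover"
  then have p: "path p" and q: "path q" by auto
  show "p\<^bsup>+\<^esup>\<^bsub>cover\<^esub> \<cdot>\<^bsub>cover\<^esub> p = p" using p by (simp add: restriction_hd)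
  show "p \<cdot>\<^bsub>cover\<^esub> p\<^bsup>*\<^esup>\<^bsub>cover\<^esub> = p" using p by (simp add: corestriction_last)
qed (auto simp: path_mult_assoc hd_path_mult last_path_mult P_comm)

interpretation cover: ehresmann_semigroup cover
  by (rule ehresmann_cover)

lemma projections_cover: "projections cover = (\<lambda>e. [e]) ` P"
proof -
  have "[e] \<in> (\<lambda>p. [hd p]) ` {p. path p}" if "e \<in> P" for e
    using that by (intro image_eqI[of _ _ "[e]"]) auto
  then show ?thesis
    unfolding projections_def[of cover] by auto
qed

lemma realize_path_mult:
  assumes "path p" "path q"
  shows "realize (path_mult p q) = realize p \<cdot> realize q"
proof -
  have "realize (path_mult p q) = realize p \<cdot> hd q \<cdot> (last p \<cdot> realize q)"
    using assms by (simp add: path_mult_def realize_glue realize_restriction realize_corestriction)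
  also have "\<dots> = (realize p \<cdot> last p) \<cdot> (hd q \<cdot> realize q)"
    using assms by (simp add: mult_assoc P_left_comm)
  also have "\<dots> = realize p \<cdot> realize q"
    using assms mult_star[of "realize p"] by (simp add: star_realize realize_hd)
  finally show ?thesis .
qed

lemma ehresmann_hom_realize: "ehresmann_hom cover S realize"
  by (auto simp: ehresmann_hom_def realize_path_mult plus_realize star_realize)

lemma realize_surj: "realize ` carrier cover = carrier S"
proof
  have "s \<in> realize ` {p. path p}" if s: "s \<in> carrier S" for s
  proof
    show "s = realize [s\<^bsup>+\<^esup>, s, s\<^bsup>*\<^esup>]" using s by (simp add: plus_mult mult_star)
    show "[s\<^bsup>+\<^esup>, s, s\<^bsup>*\<^esup>] \<in> {p. path p}" using s by (simp add: plus_mult mult_star)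
  qed
  then show "carrier S \<subseteq> realize ` carrier cover" by auto
qed auto

lemma projection_separating_realize: "projection_separating cover realize"
  by (auto simp: projection_separating_def projections_cover inj_on_def)

section \<open>Short paths\<close>

text \<open>Equality of labels is the kernel of a morphism to a free monoid, where both unary operations
  are constantly the empty word; so it is a congruence that identifies all projections.\<close>

lemma sigma_labels:
  assumes "(p, q) \<in> sigma cover"
  shows "labels p = labels q"
proof -
  let ?r = "{(p, q). path p \<and> path q \<and> labels p = labels q}"
  have "equiv {p. path p} ?r"
    by (auto simp: equiv_def refl_on_def sym_def trans_def)
  then have "ehresmann_congruence cover ?r"
    by (auto simp: ehresmann_congruence_def)
  moreover have "projections cover \<times> projections cover \<subseteq> ?r"
    by (auto simp: projections_cover)
  ultimately have "sigma cover \<subseteq> ?r"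
    by (rule cover.sigma_minimum(3))
  with assms show ?thesis by auto
qed

text \<open>A path with \<open>n\<close> edges has length \<open>2 n + 1\<close>, so these are the paths with at most one edge.\<close>

definition short_paths :: "'a list set" where
  "short_paths = {p. path p \<and> length p \<le> 3}"

lemma short_path_cases [consumes 1, case_names vertex edge]:
  assumes "p \<in> short_paths"
  obtains e where "p = [e]" "e \<in> P"
  | e x f where "p = [e, x, f]" "path [e, x, f]"
proof -
  have p: "path p" and l: "length p \<le> 3"
    using assms by (auto simp: short_paths_def)
  show thesis
  proof (cases p rule: path.cases)
    case 1 then show thesis using p by simp
  next
    case (2 e) then show thesis using p that(1) by simp
  next
    case (3 e x q)
    with p have "q \<noteq> []" by auto
    with l 3 obtain f where "q = [f]" by (cases q) auto
    then show thesis using that(2)[of e x f] p 3 by simp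
  qed
qed

lemma proper_short_path:
  assumes "p \<in> short_paths"
  shows "proper_element cover p"
  unfolding proper_element_def
proof (intro conjI ballI impI)
  show "p \<in> carrier cover" using assms by (simp add: short_paths_def)
  fix q assume "q \<in> carrier cover" and "q\<^bsup>+\<^esup>\<^bsub>cover\<^esub> = p\<^bsup>+\<^esup>\<^bsub>cover\<^esub> \<and>
    q\<^bsup>*\<^esup>\<^bsub>cover\<^esub> = p\<^bsup>*\<^esup>\<^bsub>cover\<^esub> \<and> (q, p) \<in> sigma cover"
  then have q: "path q" "hd q = hd p" "last q = last p" "labels q = labels p"
    by (auto dest: sigma_labels)
  have no_labels: "r = [hd r]" if "path r" "labels r = []" for r
    using that by (cases r rule: path.cases) auto
  from assms show "q = p"
  proof (cases rule: short_path_cases)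
    case (vertex e)
    then show ?thesis using q no_labels[of q] by simp
  next
    case (edge e x f)
    then obtain r where r: "q = e # x # r" "path r" "labels r = []"
      using q by (cases q rule: path.cases) auto
    with no_labels[of r] obtain g where "r = [g]" by blast
    then show ?thesis using r q edge by simp
  qed
qed

lemma order_ideal_short_paths: "order_ideal cover short_paths"
  by (auto simp: order_ideal_def nat_le_def projections_cover short_paths_def)

lemma projections_short: "projections cover \<subseteq> short_paths"
  by (auto simp: projections_cover short_paths_def)

section \<open>Factorizations into short paths\<close>

text \<open>The canonical factorization.  It must be nonempty, so a one-vertex path is its own only factor,
  but a path with edges contributes no factor for its last vertex.\<close>

fun edges :: "'a list \<Rightarrow> 'a list list" where
  "edges (e # x # p) = [e, x, hd p] # (if tl p = [] then [] else edges p)"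
| "edges p = [p]"

lemma edges_nonempty [simp]: "edges p \<noteq> []"
  by (cases p rule: edges.cases) auto

lemma factorization_edges: "path p \<Longrightarrow> factorization_into cover short_paths p (edges p)"
proof (induction rule: path_induct)
  case (vertex e)
  then show ?case by (simp add: cover.factorization_singleton short_paths_def)
next
  case (edge e x p)
  have a: "path [e, x, hd p]" using edge by auto
  show ?case
  proof (cases "tl p = []")
    case True
    with edge obtain f where "p = [f]" by (cases p) auto
    with a show ?thesis
      by (simp add: cover.factorization_singleton short_paths_def)
  next
    case False
    with a edge show ?thesis
      by (auto simp: cover.factorization_Cons path_mult_matching short_paths_def)
  qed
qed

lemma reduces_pair:
  assumes "factorization_into cover short_paths s (y # c # cs)" "path_mult y c \<in> short_paths"
  shows "factorizations_equivalent cover s (y # c # cs) (path_mult y c # cs)"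
proof -
  have "reduces cover s (y # c # cs) (path_mult y c # cs)"
    unfolding reduces_def
  proof (intro conjI exI)
    show "factorization_into cover {x. proper_element cover x} s (y # c # cs)"
      using assms(1) proper_short_path by (auto simp: factorization_into_def)
    show "y # c # cs = [] @ [y, c] @ cs" by simp
    have "sprod cover [y, c] = path_mult y c" by (simp add: sprod_def)
    then show "proper_element cover (sprod cover [y, c])"
      "path_mult y c # cs = [] @ [sprod cover [y, c]] @ cs"
      using proper_short_path[OF assms(2)] by simp_all
  qed simp
  then show ?thesis
    unfolding factorizations_equivalent_def by (rule r_into_equivclp)
qed

text \<open>By induction, all factors but the first can be brought into canonical form.  The first factor \<open>y\<close>
  then needs at most one more merge: it is a vertex and disappears into the next factor, or the
  rest is a vertex and disappears into \<open>y\<close>, or \<open>y\<close> is the first edge of the canonical form.\<close>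

lemma factorizations_equivalent_edges:
  assumes "factorization_into cover short_paths s xs"
  shows "factorizations_equivalent cover s xs (edges s)"
  using assms
proof (induction xs arbitrary: s)
  case Nil
  then show ?case by (simp add: factorization_into_def matching_factorization_def)
next
  case (Cons y ys)
  show ?case
  proof (cases "ys = []")
    case True
    with Cons.prems have "s = y" "y \<in> short_paths"
      by (auto simp: cover.factorization_singleton)
    from this(2) have "edges y = [y]"
      by (cases rule: short_path_cases) auto
    with True \<open>s = y\<close> show ?thesis
      by (simp add: factorizations_equivalent_def)
  next
    case False
    with Cons.prems obtain t where y: "y \<in> short_paths" and t: "factorization_into cover short_paths t ys"
      and m: "last y = hd t" and s: "s = path_mult y t"
      by (auto simp: cover.factorization_Cons)
    have pt: "path t"
      using t cover.sprod_closed
      by (auto simp: factorization_into_def matching_factorization_def)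
    have py: "path y" using y by (simp add: short_paths_def)
    have glue: "s = glue y t" using s py pt m by (simp add: path_mult_matching)
    have fe: "factorization_into cover short_paths s (y # edges t)"
      using factorization_edges[OF pt] py y m s by (auto simp: cover.factorization_Cons)
    have "factorizations_equivalent cover s (y # ys) (y # edges t)"
      using cover.factorizations_equivalent_Cons[OF Cons.IH[OF t] proper_short_path[OF y]] m s
      by simp
    moreover have "factorizations_equivalent cover s (y # edges t) (edges s)"
    proof -
      obtain c cs where c: "edges t = c # cs" by (cases "edges t") auto
      from y show ?thesis
      proof (cases rule: short_path_cases)
        case (vertex e)
        have "c \<in> short_paths" "last y = hd c"
          using fe c py unfolding c by (auto simp: factorization_into_def matching_factorization_def)
        moreover from this vertex have "path_mult y c = c"
          using path_mult_matching[OF py, of c] by (auto simp: short_paths_def)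
        ultimately show ?thesis
          using reduces_pair[of s y c cs] fe c glue vertex by simp
      next
        case (edge e x f)
        show ?thesis
        proof (cases "tl t = []")
          case True
          with pt have "t = [hd t]" by (cases t) auto
          with m edge have "t = [f]" by simp
          moreover from this have "path_mult y t = y"
            using path_mult_matching[OF py pt m] edge by simp
          ultimately show ?thesis
            using reduces_pair[of s y t "[]"] fe edge y glue by simp
        next
          case False
          with edge m glue have "edges s = y # edges t" by simp
          then show ?thesis by (simp add: factorizations_equivalent_def)
        qed
      qed
    qed
    ultimately show ?thesis
      unfolding factorizations_equivalent_def by (rule equivclp_trans)
  qed
qed

lemma proper_ehresmann_cover: "proper_ehresmann_semigroup cover"
  unfolding proper_ehresmann_semigroup_def
proof (intro conjI exI ballI allI impI)
  show "ehresmann_semigroup cover" by (rule ehresmann_cover)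
  show "order_ideal cover short_paths" by (rule order_ideal_short_paths)
  show "projections cover \<subseteq> short_paths" by (rule projections_short)
  show "proper_element cover y" if "y \<in> short_paths" for y
    using that by (rule proper_short_path)
  fix s assume "s \<in> carrier cover"
  then show "factorization_into cover short_paths s (edges s)"
    by (simp add: factorization_edges)
  fix xs ys
  assume "factorization_into cover short_paths s xs \<and> factorization_into cover short_paths s ys"
  then have "factorizations_equivalent cover s xs (edges s)"
    "factorizations_equivalent cover s ys (edges s)"
    by (auto intro: factorizations_equivalent_edges)
  then show "factorizations_equivalent cover s xs ys"
    unfolding factorizations_equivalent_def by (blast intro: equivclp_trans equivclp_sym)
qed

end

theorem theorem4p1:
  fixes S :: "'a ehresmann"
  assumes "ehresmann_semigroup S"
  shows "\<exists>(Q :: 'a list ehresmann) \<phi>. proper_cover Q S \<phi>"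
proof -
  interpret ehresmann_semigroup S by fact
  have "proper_cover cover S realize"
    unfolding proper_cover_def
    using proper_ehresmann_cover ehresmann_hom_realize realize_surj projection_separating_realize
    by blast
  then show ?thesis by blast
qed

end
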